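(* For every decomposition $A=S+R$ of the target layer $A\in\mathbb R^{n\times m}$ and every $\theta\in[0,1]$, with $A_\theta:=S+\theta R$, $$\left|\mathcal L_{\mathrm{CE}}(A_\theta)-\mathcal L_{\mathrm{CE}}(A_1)\right|\le(1-\theta)B_T(R),$$ where $$\mathcal L_{\mathrm{CE}}(A):=\frac1{|T|}\sum_{s\in T}\left[-z_A(s)_{C(s)}+\log\Big(\sum_{j=1}^K e^{z_A(s)_j}\Big)\right].$$
   Context: $T$ is a finite nonempty training set with correct classes $C(s)\in\{1,\dots,K\}$ for $s\in T$. A target layer $A\in\mathbb R^{n\times m}$ sits inside a network whose logits are $z_A(s):=\psi_2(A\psi_1(s))\in\mathbb R^K$, where $\psi_1$ (values in $\mathbb R^m$) and $\psi_2:\mathbb R^n\to\mathbb R^K$ are the pre- and post-layer maps with all other parameters frozen. For $A=S+R$ and $A_\theta=S+\theta R$, $L_s\ge 0$ is any finite upper bound on the local $\ell_\infty$-Lipschitz constant of $\psi_2$ on $\{A_\theta\psi_1(s):0\le\theta\le1\}$, i.e. $\|\psi_2(v)-\psi_2(w)\|_\infty\le L_s\|v-w\|_\infty$ for all $v,w$ in this set. The data-path budget is $$B_T(R):=\frac2{|T|}\sum_{s\in T}L_s\|R\psi_1(s)\|_\infty,$$ with $\|\cdot\|_\infty$ the vector maximum norm. *)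

theory Defs
  imports "HOL-Analysis.Analysis"
begin

text \<open>
  Dimensions are index types: \<open>m = CARD('m)\<close>, \<open>n = CARD('n)\<close>, \<open>K = CARD('k)\<close>; the classes
  \<open>1, \<dots>, K\<close> are the elements of \<open>'k\<close>. The vector maximum norm is \<^const>\<open>infnorm\<close>,
  which on \<open>real ^ 'n\<close> is \<open>max\<^sub>i \<bar>x $ i\<bar>\<close>.
\<close>

definition logits ::
  "('s \<Rightarrow> real ^ 'm) \<Rightarrow> (real ^ 'n \<Rightarrow> real ^ 'k) \<Rightarrow> real ^ 'm ^ 'n \<Rightarrow> 's \<Rightarrow> real ^ 'k" where
  "logits \<psi>1 \<psi>2 A s = \<psi>2 (A *v \<psi>1 s)"

definition ce_loss ::
  "'s set \<Rightarrow> ('s \<Rightarrow> 'k) \<Rightarrow> ('s \<Rightarrow> real ^ 'm) \<Rightarrow> (real ^ 'n \<Rightarrow> real ^ 'k) \<Rightarrow> real ^ 'm ^ 'n \<Rightarrow> real" where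
  "ce_loss T C \<psi>1 \<psi>2 A =
     1 / real (card T) *
       (\<Sum>s\<in>T. - (logits \<psi>1 \<psi>2 A s $ C s) + ln (\<Sum>j\<in>UNIV. exp (logits \<psi>1 \<psi>2 A s $ j)))"

definition layer_path :: "real ^ 'm ^ 'n \<Rightarrow> real ^ 'm ^ 'n \<Rightarrow> real \<Rightarrow> real ^ 'm ^ 'n" where
  "layer_path S R \<theta> = S + \<theta> *\<^sub>R R"

definition linf_lipschitz_bound ::
  "(real ^ 'n \<Rightarrow> real ^ 'k) \<Rightarrow> (real ^ 'n) set \<Rightarrow> real \<Rightarrow> bool" where
  "linf_lipschitz_bound f X L \<longleftrightarrow>
     0 \<le> L \<and> (\<forall>v\<in>X. \<forall>w\<in>X. infnorm (f v - f w) \<le> L * infnorm (v - w))"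

text \<open>The constants \<open>L s\<close> are not determined by the network, so the budget takes them as a parameter.\<close>

definition data_path_budget ::
  "'s set \<Rightarrow> ('s \<Rightarrow> real ^ 'm) \<Rightarrow> ('s \<Rightarrow> real) \<Rightarrow> real ^ 'm ^ 'n \<Rightarrow> real" where
  "data_path_budget T \<psi>1 L R = 2 / real (card T) * (\<Sum>s\<in>T. L s * infnorm (R *v \<psi>1 s))"

end

theory Submission
  imports Defs
begin

text \<open>
  Log-sum-exp is 1-Lipschitz in the maximum norm, so the cross entropy of a logit vector is
  2-Lipschitz. Since \<open>A\<^sub>\<theta> - A\<^sub>1 = (\<theta> - 1) R\<close>, the logits of \<open>s\<close> move by at most
  \<open>(1 - \<theta>) L\<^sub>s \<parallel>R \<psi>\<^sub>1(s)\<parallel>\<^sub>\<infinity>\<close>, and averaging over \<open>T\<close> gives the budget.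
\<close>

lemma component_diff_le_infnorm:
  fixes x y :: "real ^ 'k::finite"
  shows "\<bar>x $ i - y $ i\<bar> \<le> infnorm (x - y)"
  using component_le_infnorm_cart[of "x - y" i] by simp

text \<open>Raising every exponent by \<open>infnorm (x - y)\<close> multiplies the sum by
  \<open>exp (infnorm (x - y))\<close>, which \<open>ln\<close> turns into an additive shift. Only
  one direction is needed, since \<open>x\<close> and \<open>y\<close> can be swapped.\<close>

lemma ln_sum_exp_le:
  fixes x y :: "real ^ 'k::finite"
  shows "ln (\<Sum>j\<in>UNIV. exp (x $ j)) \<le> infnorm (x - y) + ln (\<Sum>j\<in>UNIV. exp (y $ j))"
proof -
  have pos: "(\<Sum>j\<in>UNIV. exp (z $ j)) > 0" for z :: "real ^ 'k"
    by (rule sum_pos) auto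
  have "x $ j \<le> infnorm (x - y) + y $ j" for j
    using component_diff_le_infnorm[of x j y] by linarith
  then have "(\<Sum>j\<in>UNIV. exp (x $ j)) \<le> (\<Sum>j\<in>UNIV. exp (infnorm (x - y) + y $ j))"
    by (intro sum_mono) simp
  also have "\<dots> = exp (infnorm (x - y)) * (\<Sum>j\<in>UNIV. exp (y $ j))"
    by (simp add: exp_add sum_distrib_left)
  finally have "ln (\<Sum>j\<in>UNIV. exp (x $ j)) \<le> ln (exp (infnorm (x - y)) * (\<Sum>j\<in>UNIV. exp (y $ j)))"
    using pos by simp
  then show ?thesis
    using pos[of y] by (simp add: ln_mult)
qed

text \<open>The constant 2 is one unit from the true-class coordinate and one from
  log-sum-exp.\<close>

lemma cross_entropy_lipschitz:
  fixes x y :: "real ^ 'k::finite"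
  shows "\<bar>(- (x $ i) + ln (\<Sum>j\<in>UNIV. exp (x $ j))) - (- (y $ i) + ln (\<Sum>j\<in>UNIV. exp (y $ j)))\<bar>
           \<le> 2 * infnorm (x - y)"
  using component_diff_le_infnorm[of x i y] ln_sum_exp_le[of x y] ln_sum_exp_le[of y x]
  by (simp add: infnorm_sub[of y x])

theorem lemma5p1:
  fixes T :: "'s set" and C :: "'s \<Rightarrow> 'k::finite"
    and \<psi>1 :: "'s \<Rightarrow> real ^ 'm::finite" and \<psi>2 :: "real ^ 'n::finite \<Rightarrow> real ^ 'k"
    and A S R :: "real ^ 'm ^ 'n" and L :: "'s \<Rightarrow> real" and \<theta> :: real
  assumes "finite T" and "T \<noteq> {}"
    and "A = S + R"
    and "\<And>s. s \<in> T \<Longrightarrow>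
           linf_lipschitz_bound \<psi>2 {layer_path S R t *v \<psi>1 s | t. 0 \<le> t \<and> t \<le> 1} (L s)"
    and "0 \<le> \<theta>" and "\<theta> \<le> 1"
  shows "\<bar>ce_loss T C \<psi>1 \<psi>2 (layer_path S R \<theta>) - ce_loss T C \<psi>1 \<psi>2 (layer_path S R 1)\<bar>
           \<le> (1 - \<theta>) * data_path_budget T \<psi>1 L R"
proof -
  let ?z = "\<lambda>t. logits \<psi>1 \<psi>2 (layer_path S R t)"
  let ?ce = "\<lambda>t s. - (?z t s $ C s) + ln (\<Sum>j\<in>UNIV. exp (?z t s $ j))"
  have z: "infnorm (?z \<theta> s - ?z 1 s) \<le> L s * ((1 - \<theta>) * infnorm (R *v \<psi>1 s))" if "s \<in> T" for s
  proof -
    let ?v = "\<lambda>t. layer_path S R t *v \<psi>1 s"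
    have "?v \<theta> - ?v 1 = (\<theta> - 1) *\<^sub>R (R *v \<psi>1 s)"
      by (simp add: layer_path_def matrix_vector_mult_add_rdistrib scaleR_matrix_vector_assoc
          [symmetric] scaleR_left_diff_distrib)
    \<comment> \<open>Here \<open>\<bar>\<theta> - 1\<bar> = 1 - \<theta>\<close>, because
      \<open>\<theta> \<le> 1\<close>.\<close>
    then have "infnorm (?v \<theta> - ?v 1) = (1 - \<theta>) * infnorm (R *v \<psi>1 s)"
      using \<open>\<theta> \<le> 1\<close> by (simp add: infnorm_mul)
    \<comment> \<open>Both points lie on the segment where \<open>L s\<close> is a valid bound, with
      parameters \<open>t = \<theta>\<close> and \<open>t = 1\<close>.\<close>
    moreover have "infnorm (\<psi>2 (?v \<theta>) - \<psi>2 (?v 1)) \<le> L s * infnorm (?v \<theta> - ?v 1)"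
      using assms(4)[OF that] assms(5,6) unfolding linf_lipschitz_bound_def by fastforce
    ultimately show ?thesis
      by (simp add: logits_def)
  qed
  have "\<bar>ce_loss T C \<psi>1 \<psi>2 (layer_path S R \<theta>) - ce_loss T C \<psi>1 \<psi>2 (layer_path S R 1)\<bar>
      = 1 / real (card T) * \<bar>\<Sum>s\<in>T. ?ce \<theta> s - ?ce 1 s\<bar>"
    unfolding ce_loss_def right_diff_distrib[symmetric] sum_subtractf[symmetric] abs_mult by simp
  also have "\<dots> \<le> 1 / real (card T) * (\<Sum>s\<in>T. 2 * (L s * ((1 - \<theta>) * infnorm (R *v \<psi>1 s))))"
  \<comment> \<open>The triangle inequality over \<open>T\<close> reduces the claim to one sample at
    a time; the remaining side goal is that \<open>1 / real (card T)\<close> is nonnegative.\<close>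
  proof (intro mult_left_mono order_trans[OF sum_abs] sum_mono)
    show "\<bar>?ce \<theta> s - ?ce 1 s\<bar> \<le> 2 * (L s * ((1 - \<theta>) * infnorm (R *v \<psi>1 s)))" if "s \<in> T" for s
      using cross_entropy_lipschitz[of "?z \<theta> s" "C s" "?z 1 s"] z[OF that] by linarith
  qed simp
  \<comment> \<open>The factor 2 in the budget is the Lipschitz constant of the cross
    entropy.\<close>
  also have "\<dots> = (1 - \<theta>) * data_path_budget T \<psi>1 L R"
    by (simp add: data_path_budget_def sum_distrib_left mult_ac)
  finally show ?thesis .
qed

end
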